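(* Let $a\in\mathbb R$. The central version of the semi-discrete Active Flux method for the linear advection equation $\partial_tu+a\,\partial_xu=0$ with periodic boundary conditions on a uniform grid with $n$ cells is stable.
   Context: Grid: $[x_{\min},x_{\max}]$ is divided into $n$ cells $[x_{i-1/2},x_{i+1/2}]$, $i=0,\dots,n-1$, of equal length $\Delta x=(x_{\max}-x_{\min})/n$. Degrees of freedom are cell averages $u_i$ and point values $u_{i+1/2}$ at cell interfaces. By periodicity $u_{i+n}=u_i$ and $u_{i+n+1/2}=u_{i+1/2}$ (cell indices modulo $n$). They are collected in $\mathbf u=(u_{-1/2},u_0,u_{1/2},u_1,\dots,u_{n-3/2},u_{n-1})^T\in\mathbb R^{2n}$. Central semi-discrete Active Flux method: for all $i$, $$\frac{\mathrm d}{\mathrm dt}u_i+a\,\frac{u_{i+1/2}-u_{i-1/2}}{\Delta x}=0,\qquad \frac{\mathrm d}{\mathrm dt}u_{i+1/2}+a\,\frac{u_{i-1/2}-3u_i+3u_{i+1}-u_{i+3/2}}{\Delta x}=0 .$$ Stable (for a linear semi-discretization on a given grid): there is a constant $C$, depending only on the grid and the scheme, such that every solution satisfies $\|\mathbf u(t)\|\le C\|\mathbf u(0)\|$ for all $t\ge0$, where $\|\cdot\|$ is the Euclidean norm. Equivalently, there is a symmetric positive definite matrix $M$ such that $\frac{\mathrm d}{\mathrm dt}\|\mathbf u\|_M^2=\frac{\mathrm d}{\mathrm dt}(\mathbf u^TM\mathbf u)\le0$ for every solution. *)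

theory Defs
  imports "HOL-Analysis.Analysis"
begin

text \<open>
  A vector of degrees of freedom in \<open>\<real>\<^sup>2\<^sup>n\<close> is a function \<open>v :: nat \<Rightarrow> real\<close> of which only the
  components \<open>v 0, \<dots>, v (2 * n - 1)\<close> are used, ordered as
  \<open>(u\<^bsub>-1/2\<^esub>, u\<^bsub>0\<^esub>, u\<^bsub>1/2\<^esub>, u\<^bsub>1\<^esub>, \<dots>, u\<^bsub>n-3/2\<^esub>, u\<^bsub>n-1\<^esub>)\<close>. The value carried by the grid position
  \<open>x\<close> (an integer or a half-integer) thus sits at index \<open>2 * x + 1\<close>, and periodicity means that
  this index is taken modulo \<open>2 * n\<close>.
\<close>

definition cell_average :: "nat \<Rightarrow> (nat \<Rightarrow> real) \<Rightarrow> int \<Rightarrow> real" where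
  "cell_average n v i = v (nat ((2 * i + 1) mod (2 * int n)))"

text \<open>\<open>point_value n v i\<close> is the value \<open>u\<^bsub>i+1/2\<^esub>\<close> at the right interface of cell \<open>i\<close>.\<close>

definition point_value :: "nat \<Rightarrow> (nat \<Rightarrow> real) \<Rightarrow> int \<Rightarrow> real" where
  "point_value n v i = v (nat ((2 * i + 2) mod (2 * int n)))"

lemma cell_average_periodic: "cell_average n v (i + int n) = cell_average n v i"
proof -
  have "2 * (i + int n) + 1 = (2 * i + 1) + 2 * int n" by simp
  then show ?thesis unfolding cell_average_def by (metis mod_add_self2)
qed

lemma point_value_periodic: "point_value n v (i + int n) = point_value n v i"
proof -
  have "2 * (i + int n) + 2 = (2 * i + 2) + 2 * int n" by simp
  then show ?thesis unfolding point_value_def by (metis mod_add_self2)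
qed

lemma cell_average_component: "i < n \<Longrightarrow> cell_average n v (int i) = v (2 * i + 1)"
  by (simp add: cell_average_def nat_add_distrib nat_mult_distrib)

lemma point_value_component: "i < n \<Longrightarrow> point_value n v (int i - 1) = v (2 * i)"
  by (simp add: point_value_def nat_mult_distrib)

definition cell_width :: "real \<Rightarrow> real \<Rightarrow> nat \<Rightarrow> real" where
  "cell_width xmin xmax n = (xmax - xmin) / real n"

text \<open>
  Time is restricted to \<open>t \<ge> 0\<close>, so the derivative at \<open>t = 0\<close> is one-sided.
\<close>

definition central_AF_solution ::
  "real \<Rightarrow> real \<Rightarrow> real \<Rightarrow> nat \<Rightarrow> (real \<Rightarrow> nat \<Rightarrow> real) \<Rightarrow> bool" where
  "central_AF_solution a xmin xmax n u \<longleftrightarrow>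
    (\<forall>t\<ge>0. \<forall>i::int.
      ((\<lambda>s. cell_average n (u s) i) has_real_derivative
        - (a * (point_value n (u t) i - point_value n (u t) (i - 1)) / cell_width xmin xmax n))
        (at t within {0..}) \<and>
      ((\<lambda>s. point_value n (u s) i) has_real_derivative
        - (a * (point_value n (u t) (i - 1) - 3 * cell_average n (u t) i
                + 3 * cell_average n (u t) (i + 1) - point_value n (u t) (i + 1))
           / cell_width xmin xmax n))
        (at t within {0..}))"

text \<open>
  A semi-discretization with \<open>N\<close> degrees of freedom on a given grid enters through the
  predicate that singles out its solutions. As \<open>C\<close> is chosen before the solution, it depends
  on the grid and the scheme only.
\<close>

definition stable_semidiscretization :: "nat \<Rightarrow> ((real \<Rightarrow> nat \<Rightarrow> real) \<Rightarrow> bool) \<Rightarrow> bool" where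
  "stable_semidiscretization N is_solution \<longleftrightarrow>
    (\<exists>C. \<forall>u. is_solution u \<longrightarrow>
      (\<forall>t\<ge>0. L2_set (u t) {..<N} \<le> C * L2_set (u 0) {..<N}))"

end

theory Submission
  imports Defs
begin

text \<open>
  The central Active Flux method conserves the quadratic form
  \<open>\<Sum>i<n. 3 u\<^bsub>i\<^esub>\<^sup>2 + u\<^bsub>i+1/2\<^esub>\<^sup>2\<close>. The flux differences drive the averages by point values, and the
  average differences drive the point values by averages; the factor 3 between these two couplings
  is exactly the weight of the averages, so that the coupling terms cancel up to a
  telescoping remainder. The remaining term
  \<open>u\<^bsub>i+1/2\<^esub> (u\<^bsub>i-1/2\<^esub> - u\<^bsub>i+3/2\<^esub>)\<close> comes from a central, hence skew-symmetric, difference. The rate of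
  change of the energy is therefore a sum of differences \<open>g i - g (i - 1)\<close> of a periodic function
  (lemma \<open>AF_energy_rate_telescopes\<close>), which vanishes. The quadratic form lies between the
  squared Euclidean norm and three times that, so stability holds with the constant \<open>sqrt 3\<close>.
\<close>

definition AF_energy :: "nat \<Rightarrow> (nat \<Rightarrow> real) \<Rightarrow> real" where
  "AF_energy n v = (\<Sum>i<n. 3 * (cell_average n v (int i))\<^sup>2 + (point_value n v (int i))\<^sup>2)"

lemma sum_shift_periodic:
  fixes f :: "int \<Rightarrow> real"
  assumes periodic: "\<And>i. f (i + int n) = f i"
  shows "(\<Sum>i<n. f (int i - 1)) = (\<Sum>i<n. f (int i))"
proof -
  have "(\<Sum>i<n. f (int i) - f (int i - 1)) = f (int n - 1) - f (- 1)"
    using sum_lessThan_telescope[of "\<lambda>i. f (int i - 1)" n] by simp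
  also have "\<dots> = 0"
    using periodic[of "- 1"] by simp
  finally show ?thesis
    by (simp add: sum_subtractf)
qed

lemma sum_even_odd:
  fixes f :: "nat \<Rightarrow> 'a::comm_monoid_add"
  shows "sum f {..<2 * n} = (\<Sum>i<n. f (2 * i + 1) + f (2 * i))"
  by (induction n) (auto simp: algebra_simps)

text \<open>
  Point values are stored at the left interface of a cell but indexed by the cell whose right
  interface they are, so the two enumerations of them differ by a periodic shift.
\<close>

lemma L2_set_eq_averages_points:
  "(L2_set v {..<2 * n})\<^sup>2
    = (\<Sum>i<n. (cell_average n v (int i))\<^sup>2 + (point_value n v (int i))\<^sup>2)"
proof -
  have "(L2_set v {..<2 * n})\<^sup>2 = (\<Sum>j<2 * n. (v j)\<^sup>2)"
    by (simp add: L2_set_def sum_nonneg)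
  also have "\<dots> = (\<Sum>i<n. (v (2 * i + 1))\<^sup>2 + (v (2 * i))\<^sup>2)"
    by (rule sum_even_odd)
  also have "\<dots> = (\<Sum>i<n. (cell_average n v (int i))\<^sup>2 + (point_value n v (int i - 1))\<^sup>2)"
    by (intro sum.cong refl) (simp only: lessThan_iff cell_average_component point_value_component)
  also have "\<dots> = (\<Sum>i<n. (cell_average n v (int i))\<^sup>2 + (point_value n v (int i))\<^sup>2)"
    using sum_shift_periodic[of "\<lambda>i. (point_value n v i)\<^sup>2" n]
    by (simp add: sum.distrib point_value_periodic)
  finally show ?thesis .
qed

lemma L2_set_le_AF_energy: "(L2_set v {..<2 * n})\<^sup>2 \<le> AF_energy n v"
  unfolding L2_set_eq_averages_points AF_energy_def by (intro sum_mono) simp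

lemma AF_energy_le_L2_set: "AF_energy n v \<le> 3 * (L2_set v {..<2 * n})\<^sup>2"
  unfolding L2_set_eq_averages_points AF_energy_def sum_distrib_left by (intro sum_mono) simp

text \<open>
  Conservation is local: with \<open>A\<close> the averages and \<open>P\<close> the right point values, the summand is the
  energy rate of one cell up to a constant factor, and it is the difference \<open>g i - g (i - 1)\<close> of
  the discrete energy flux \<open>g i = 3 P\<^bsub>i\<^esub> A\<^bsub>i+1\<^esub> - P\<^bsub>i\<^esub> P\<^bsub>i+1\<^esub>\<close>.
\<close>

lemma AF_energy_rate_telescopes:
  fixes A P :: "int \<Rightarrow> real"
  assumes A: "\<And>i. A (i + int n) = A i" and P: "\<And>i. P (i + int n) = P i"
  shows "(\<Sum>i<n. 3 * A (int i) * (P (int i) - P (int i - 1))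
           + P (int i) * (P (int i - 1) - 3 * A (int i) + 3 * A (int i + 1) - P (int i + 1))) = 0"
proof -
  define g where "g i = 3 * P i * A (i + 1) - P i * P (i + 1)" for i
  have "g (i + int n) = g i" for i
    using A[of "i + 1"] P[of i] P[of "i + 1"] by (simp add: g_def add_ac)
  then have "(\<Sum>i<n. g (int i) - g (int i - 1)) = 0"
    using sum_shift_periodic[of g n] by (simp add: sum_subtractf)
  then show ?thesis
    by (simp add: g_def algebra_simps)
qed

lemma AF_energy_has_derivative_zero:
  assumes sol: "central_AF_solution a xmin xmax n u" and "t \<ge> 0"
  shows "((\<lambda>s. AF_energy n (u s)) has_real_derivative 0) (at t within {0..})"
proof -
  define h where "h = cell_width xmin xmax n"
  define A where "A i = cell_average n (u t) i" for i
  define P where "P i = point_value n (u t) i" for i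
  define A' where "A' i = - (a * (P i - P (i - 1)) / h)" for i
  define P' where "P' i = - (a * (P (i - 1) - 3 * A i + 3 * A (i + 1) - P (i + 1)) / h)" for i
  have dA: "((\<lambda>s. cell_average n (u s) i) has_real_derivative A' i) (at t within {0..})"
    and dP: "((\<lambda>s. point_value n (u s) i) has_real_derivative P' i) (at t within {0..})" for i
    using sol \<open>t \<ge> 0\<close> unfolding central_AF_solution_def A'_def P'_def A_def P_def h_def by auto
  have "((\<lambda>s. AF_energy n (u s)) has_real_derivative
      (\<Sum>i<n. 3 * (2 * A (int i) * A' (int i)) + 2 * P (int i) * P' (int i))) (at t within {0..})"
    unfolding AF_energy_def A_def P_def
    by (auto intro!: derivative_eq_intros dA dP sum.cong)
  moreover have "(\<Sum>i<n. 3 * (2 * A (int i) * A' (int i)) + 2 * P (int i) * P' (int i))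
      = - (2 * a / h) * (\<Sum>i<n. 3 * A (int i) * (P (int i) - P (int i - 1))
          + P (int i) * (P (int i - 1) - 3 * A (int i) + 3 * A (int i + 1) - P (int i + 1)))"
    unfolding sum_distrib_left A'_def P'_def
    by (intro sum.cong refl) (simp add: divide_inverse algebra_simps)
  moreover have "(\<Sum>i<n. 3 * A (int i) * (P (int i) - P (int i - 1))
      + P (int i) * (P (int i - 1) - 3 * A (int i) + 3 * A (int i + 1) - P (int i + 1))) = 0"
    by (rule AF_energy_rate_telescopes)
      (simp_all add: A_def P_def cell_average_periodic point_value_periodic)
  ultimately show ?thesis
    by simp
qed

lemma AF_energy_conserved:
  assumes "central_AF_solution a xmin xmax n u" and "t \<ge> 0"
  shows "AF_energy n (u t) = AF_energy n (u 0)"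
proof -
  have "\<exists>c. \<forall>s\<in>{0..}. AF_energy n (u s) = c"
    using AF_energy_has_derivative_zero[OF assms(1)]
    by (intro has_field_derivative_zero_constant) auto
  with \<open>t \<ge> 0\<close> show ?thesis
    by auto
qed

theorem corollary4p1:
  fixes a xmin xmax :: real and n :: nat
  assumes "xmin < xmax" and "n \<ge> 1"
  shows "stable_semidiscretization (2 * n) (central_AF_solution a xmin xmax n)"
  unfolding stable_semidiscretization_def
proof (intro exI[of _ "sqrt 3"] allI impI)
  fix u :: "real \<Rightarrow> nat \<Rightarrow> real" and t :: real
  assume "central_AF_solution a xmin xmax n u" and "t \<ge> 0"
  then have "AF_energy n (u t) = AF_energy n (u 0)"
    by (rule AF_energy_conserved)
  then have "(L2_set (u t) {..<2 * n})\<^sup>2 \<le> 3 * (L2_set (u 0) {..<2 * n})\<^sup>2"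
    using L2_set_le_AF_energy[of "u t" n] AF_energy_le_L2_set[of n "u 0"] by linarith
  then have "(L2_set (u t) {..<2 * n})\<^sup>2 \<le> (sqrt 3 * L2_set (u 0) {..<2 * n})\<^sup>2"
    by (simp add: power_mult_distrib)
  then show "L2_set (u t) {..<2 * n} \<le> sqrt 3 * L2_set (u 0) {..<2 * n}"
    by (rule power2_le_imp_le) (simp add: L2_set_nonneg)
qed

end
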